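(* Let $k\ge 1$ be an integer and let $G$ be a $k$-connected graph with minimum degree $\delta(G)\ge k+1$. Then $G$ contains a $k$-removable $2$-matching, unless $k=1$ and $G$ is a cycle.
   Context: All graphs are finite, undirected and simple. A graph $G$ is $k$-connected ($k\ge1$) if it has more than $k$ vertices and $G-S$ is connected for every vertex set $S$ with $|S|\le k-1$; in particular $1$-connected means connected (with at least two vertices). $\delta(G)$ is the minimum degree of $G$. For $F\subseteq E(G)$, $G-F$ is the graph with vertex set $V(G)$ and edge set $E(G)\setminus F$. A matching is a set of pairwise vertex-disjoint edges; an $\ell$-matching is a matching with exactly $\ell$ edges. A matching $M$ in a $k$-connected graph $G$ is $k$-removable if $G-M$ is still $k$-connected. *)

theory Defs
  imports Main
begin

record 'a graph =
  verts :: "'a set"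
  edges :: "'a set set"

definition simple_graph :: "'a graph \<Rightarrow> bool" where
  "simple_graph G \<longleftrightarrow>
     finite (verts G) \<and> (\<forall>e\<in>edges G. e \<subseteq> verts G \<and> card e = 2)"

definition delete_verts :: "'a graph \<Rightarrow> 'a set \<Rightarrow> 'a graph" where
  "delete_verts G S = \<lparr>verts = verts G - S, edges = {e \<in> edges G. e \<inter> S = {}}\<rparr>"

definition delete_edges :: "'a graph \<Rightarrow> 'a set set \<Rightarrow> 'a graph" where
  "delete_edges G F = \<lparr>verts = verts G, edges = edges G - F\<rparr>"

definition adj_rel :: "'a graph \<Rightarrow> ('a \<times> 'a) set" where
  "adj_rel G = {(u, v). {u, v} \<in> edges G}"

definition connected_graph :: "'a graph \<Rightarrow> bool" where
  "connected_graph G \<longleftrightarrow> (\<forall>u\<in>verts G. \<forall>v\<in>verts G. (u, v) \<in> (adj_rel G)\<^sup>*)"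

(* Only meant for k >= 1, where card S < k is the same as card S <= k - 1. *)
definition k_connected :: "nat \<Rightarrow> 'a graph \<Rightarrow> bool" where
  "k_connected k G \<longleftrightarrow>
     card (verts G) > k \<and>
     (\<forall>S\<subseteq>verts G. card S < k \<longrightarrow> connected_graph (delete_verts G S))"

definition degree :: "'a graph \<Rightarrow> 'a \<Rightarrow> nat" where
  "degree G v = card {e \<in> edges G. v \<in> e}"

(* Min is meaningful here only for a finite nonempty vertex set. *)
definition min_degree :: "'a graph \<Rightarrow> nat" where
  "min_degree G = Min (degree G ` verts G)"

definition matching :: "'a graph \<Rightarrow> 'a set set \<Rightarrow> bool" where
  "matching G M \<longleftrightarrow> M \<subseteq> edges G \<and> (\<forall>e\<in>M. \<forall>f\<in>M. e \<noteq> f \<longrightarrow> e \<inter> f = {})"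

definition l_matching :: "nat \<Rightarrow> 'a graph \<Rightarrow> 'a set set \<Rightarrow> bool" where
  "l_matching l G M \<longleftrightarrow> matching G M \<and> card M = l"

definition k_removable :: "nat \<Rightarrow> 'a graph \<Rightarrow> 'a set set \<Rightarrow> bool" where
  "k_removable k G M \<longleftrightarrow> matching G M \<and> k_connected k (delete_edges G M)"

(* G is a cycle as a whole graph: vs lists all vertices once, in cyclic order. *)
definition is_cycle :: "'a graph \<Rightarrow> bool" where
  "is_cycle G \<longleftrightarrow>
     (\<exists>vs. distinct vs \<and> length vs \<ge> 3 \<and> set vs = verts G \<and>
        edges G = {{vs ! i, vs ! (Suc i mod length vs)} | i. i < length vs})"

end

theory Submission imports Defs begin

text \<open>
  Call an edge of a \<open>k\<close>-connected graph critical if deleting it destroys \<open>k\<close>-connectivity.  The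
  engine is a theorem of Mader: a nonempty set of critical edges all of whose ends have degree
  greater than \<open>k\<close> has a vertex that lies on exactly one of the edges
  (\<open>mader_critical_edges\<close>).  Applied to all subsets, it says that such a set of edges is a forest.

  Since every vertex of \<open>G\<close> lies on at least \<open>k + 1 \<ge> 2\<close> edges, not all edges are critical.
  Fix an edge \<open>uv\<close> that is not, and suppose that there is no \<open>k\<close>-removable 2-matching.  The graph
  \<open>G - uv\<close> is \<open>k\<close>-connected, and there every edge that avoids \<open>u\<close> and \<open>v\<close> is critical, as otherwise
  it would form a removable matching together with \<open>uv\<close>.  Only \<open>u\<close> and \<open>v\<close> have lost degree, so by
  Mader's theorem the set \<open>F\<close> of these edges is a forest.  A vertex other than \<open>u\<close> and \<open>v\<close> has at
  most two edges to \<open>{u, v}\<close> and hence degree at least \<open>k - 1\<close> in \<open>F\<close>.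

  If \<open>k \<ge> 3\<close>, the forest \<open>F\<close> would have no leaf.

  If \<open>k = 2\<close>, every leaf of \<open>F\<close> is adjacent to both \<open>u\<close> and \<open>v\<close>.  Take two leaves \<open>w\<close> and \<open>w'\<close> and
  delete \<open>uw\<close> and \<open>vw'\<close> instead of \<open>uv\<close>.  Every leaf keeps an edge to \<open>u\<close> or \<open>v\<close>, every tree in
  \<open>F\<close> has a leaf to spare, and \<open>uv\<close> joins \<open>u\<close> to \<open>v\<close>; so this matching is removable
  (\<open>removable_if_two_connected\<close>).

  If \<open>k = 1\<close>, the same exchange is tried with neighbours \<open>w\<close> of \<open>u\<close> and \<open>w'\<close> of \<open>v\<close>.  It fails only
  if \<open>uw\<close> and \<open>vw'\<close> are the only edges joining the tree of \<open>w\<close> and \<open>w'\<close> to \<open>{u, v}\<close>, and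
  then this tree is a path from \<open>w\<close> to \<open>w'\<close>.  As it fails for every choice of \<open>w \<noteq> w'\<close>, there is
  just one tree; and if no such choice exists, \<open>G\<close> is a triangle.  In both cases all degrees of \<open>G\<close>
  are 2 (\<open>two_regular_if_not_removable\<close>), and a connected graph with this property is a cycle.
\<close>

section \<open>Separations\<close>

definition separation :: "'a graph \<Rightarrow> 'a set \<Rightarrow> 'a set \<Rightarrow> 'a set \<Rightarrow> bool" where
  "separation G A S X \<longleftrightarrow>
     verts G = A \<union> S \<union> X \<and> A \<inter> S = {} \<and> A \<inter> X = {} \<and> S \<inter> X = {} \<and>
     A \<noteq> {} \<and> X \<noteq> {} \<and> (\<forall>p\<in>A. \<forall>q\<in>X. {p, q} \<notin> edges G)"

lemma separation_sym: "separation G A S X \<Longrightarrow> separation G X S A"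
  unfolding separation_def by (metis Int_commute Un_assoc Un_commute insert_commute)

text \<open>Working with partitions of the vertex set instead of reachability makes the symmetry between
  the two sides and the counting arguments below available.\<close>

lemma k_connected_iff_separation:
  assumes "simple_graph G"
  shows "k_connected k G \<longleftrightarrow>
    k < card (verts G) \<and> (\<forall>A S X. separation G A S X \<longrightarrow> k \<le> card S)"
proof (intro iffI conjI allI impI)
  assume G: "k_connected k G"
  show "k < card (verts G)" using G by (simp add: k_connected_def)
  fix A S X assume sep: "separation G A S X"
  show "k \<le> card S"
  proof (rule ccontr)
    assume "\<not> k \<le> card S"
    moreover have "S \<subseteq> verts G" using sep by (auto simp: separation_def)
    ultimately have con: "connected_graph (delete_verts G S)"
      using G by (auto simp: k_connected_def)
    obtain u v where uv: "u \<in> A" "v \<in> X" using sep by (auto simp: separation_def)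
    have "u \<in> verts (delete_verts G S)" "v \<in> verts (delete_verts G S)"
      using uv sep by (auto simp: separation_def delete_verts_def)
    then have "(u, v) \<in> (adj_rel (delete_verts G S))\<^sup>*"
      using con by (auto simp: connected_graph_def)
    then have "v \<in> A"
    proof (induction)
      case base
      show ?case using uv by simp
    next
      case (step y z)
      then have e: "{y, z} \<in> edges G" "z \<notin> S"
        by (auto simp: adj_rel_def delete_verts_def)
      then have "z \<in> verts G" using assms by (auto simp: simple_graph_def)
      then show ?case using e step.IH sep by (auto simp: separation_def)
    qed
    then show False using uv sep by (auto simp: separation_def)
  qed
next
  assume R: "k < card (verts G) \<and> (\<forall>A S X. separation G A S X \<longrightarrow> k \<le> card S)"
  show "k_connected k G"
    unfolding k_connected_def
  proof (intro conjI allI impI)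
    show "k < card (verts G)" using R by blast
    fix S assume S: "S \<subseteq> verts G" "card S < k"
    show "connected_graph (delete_verts G S)"
    proof (rule ccontr)
      assume "\<not> ?thesis"
      then obtain u v where uv: "u \<in> verts G - S" "v \<in> verts G - S"
        "(u, v) \<notin> (adj_rel (delete_verts G S))\<^sup>*"
        by (auto simp: connected_graph_def delete_verts_def)
      define A where "A = {w \<in> verts G - S. (u, w) \<in> (adj_rel (delete_verts G S))\<^sup>*}"
      have "{p, q} \<notin> edges G" if "p \<in> A" "q \<in> verts G - S - A" for p q
      proof
        assume "{p, q} \<in> edges G"
        then have "(p, q) \<in> adj_rel (delete_verts G S)"
          using that by (auto simp: A_def adj_rel_def delete_verts_def)
        then have "q \<in> A" using that by (auto simp: A_def intro: rtrancl_into_rtrancl)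
        then show False using that by simp
      qed
      then have "separation G A S (verts G - S - A)"
        using S uv by (auto simp: separation_def A_def)
      then show False using R S by force
    qed
  qed
qed

lemma simple_graph_delete_edges: "simple_graph G \<Longrightarrow> simple_graph (delete_edges G M)"
  by (auto simp: simple_graph_def delete_edges_def)

text \<open>This is the form in which connectivity enters all counting arguments: \<open>Q\<close> contains the
  neighbourhood of \<open>P\<close>, and the vertex \<open>z\<close> shows that something is left beyond \<open>Q\<close>.\<close>

lemma k_le_card_if_separating:
  assumes "simple_graph G" "k_connected k G"
    and P: "P \<subseteq> verts G" "P \<noteq> {}" and "finite Q"
    and N: "\<And>p y. p \<in> P \<Longrightarrow> {p, y} \<in> edges G \<Longrightarrow> y \<in> P \<union> Q"
    and z: "z \<in> verts G" "z \<notin> P" "z \<notin> Q"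
  shows "k \<le> card Q"
proof -
  have "separation G P (verts G \<inter> Q - P) (verts G - P - Q)"
    using P z N by (auto simp: separation_def)
  then have "k \<le> card (verts G \<inter> Q - P)"
    using assms(1,2) by (auto simp: k_connected_iff_separation)
  also have "\<dots> \<le> card Q" using \<open>finite Q\<close> by (intro card_mono) auto
  finally show ?thesis .
qed

section \<open>Critical edges\<close>

text \<open>Degrees are needed with respect to sets of edges that do not come as the edge set of a graph.\<close>

definition deg :: "'a set set \<Rightarrow> 'a \<Rightarrow> nat" where
  "deg H v = card {e \<in> H. v \<in> e}"

lemma degree_eq_deg: "degree G v = deg (edges G) v"
  by (simp add: degree_def deg_def)

lemma deg_le_card_neighbours:
  assumes "\<And>e. e \<in> H \<Longrightarrow> card e = 2" "finite Q"
    and "\<And>y. {v, y} \<in> H \<Longrightarrow> y \<in> Q"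
  shows "deg H v \<le> card Q"
proof -
  have "{e \<in> H. v \<in> e} \<subseteq> (\<lambda>y. {v, y}) ` Q"
  proof
    fix e assume e: "e \<in> {e \<in> H. v \<in> e}"
    then obtain y where "e = {v, y}" using assms(1)[of e] by (auto simp: card_2_iff)
    then show "e \<in> (\<lambda>y. {v, y}) ` Q" using e assms(3) by auto
  qed
  then have "deg H v \<le> card ((\<lambda>y. {v, y}) ` Q)"
    unfolding deg_def using \<open>finite Q\<close> by (intro card_mono) auto
  also have "\<dots> \<le> card Q" by (rule card_image_le[OF \<open>finite Q\<close>])
  finally show ?thesis .
qed

text \<open>A witness that the edge \<open>ax\<close> is critical: it is the only edge from \<open>A\<close> to \<open>X\<close>, and so \<open>S\<close>, which
  has fewer than \<open>k\<close> vertices, separates \<open>A\<close> from \<open>X\<close> once \<open>ax\<close> is deleted.\<close>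

definition edge_split ::
  "nat \<Rightarrow> 'a graph \<Rightarrow> 'a set \<Rightarrow> 'a set \<Rightarrow> 'a set \<Rightarrow> 'a \<Rightarrow> 'a \<Rightarrow> bool" where
  "edge_split k G A S X a x \<longleftrightarrow>
     verts G = A \<union> S \<union> X \<and> A \<inter> S = {} \<and> A \<inter> X = {} \<and> S \<inter> X = {} \<and>
     a \<in> A \<and> x \<in> X \<and> card S < k \<and>
     (\<forall>p\<in>A. \<forall>q\<in>X. {p, q} \<in> edges G \<longrightarrow> p = a \<and> q = x)"

lemma edge_split_sym: "edge_split k G A S X a x \<Longrightarrow> edge_split k G X S A x a"
  unfolding edge_split_def by (metis Int_commute Un_assoc Un_commute insert_commute)

text \<open>A separation of \<open>G - pq\<close> by fewer than \<open>k\<close> vertices is not one of \<open>G\<close>, so the deleted edge has to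
  run between its two sides.\<close>

lemma critical_edge_split:
  assumes "simple_graph G" "k_connected k G"
    and crit: "\<not> k_connected k (delete_edges G {{p, q}})"
  shows "\<exists>A S X. edge_split k G A S X p q"
proof -
  let ?G' = "delete_edges G {{p, q}}"
  have "k < card (verts ?G')"
    using assms by (simp add: k_connected_def delete_edges_def)
  then obtain A S X where sep: "separation ?G' A S X" and S: "card S < k"
    using crit k_connected_iff_separation[OF simple_graph_delete_edges[OF assms(1)]]
    by (meson not_le)
  have "\<not> separation G A S X"
    using S assms(1,2) k_connected_iff_separation[of G k] by (meson not_le)
  then obtain p' q' where pq: "p' \<in> A" "q' \<in> X" "{p', q'} \<in> edges G"
    using sep by (auto simp: separation_def delete_edges_def)
  then have eq: "{p', q'} = {p, q}"
    using sep by (auto simp: separation_def delete_edges_def)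
  have "edge_split k G A S X p' q'"
    unfolding edge_split_def
  proof (intro conjI ballI impI)
    fix y z assume yz: "y \<in> A" "z \<in> X" "{y, z} \<in> edges G"
    then have "{y, z} = {p', q'}"
      using sep eq by (auto simp: separation_def delete_edges_def)
    moreover have "y \<noteq> q'" using yz pq sep by (auto simp: separation_def)
    ultimately show "y = p'" "z = q'" by (auto simp: doubleton_eq_iff)
  qed (use sep pq S in \<open>auto simp: separation_def delete_edges_def\<close>)
  then show ?thesis
    using eq edge_split_sym by (metis doubleton_eq_iff)
qed

lemma card_three_parts:
  assumes "finite Z" "Z \<subseteq> C \<union> T \<union> D" "C \<inter> T = {}" "C \<inter> D = {}" "T \<inter> D = {}"
  shows "card Z = card (Z \<inter> C) + card (Z \<inter> T) + card (Z \<inter> D)"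
proof -
  have "card (Z \<inter> C \<union> Z \<inter> T) = card (Z \<inter> C) + card (Z \<inter> T)"
    by (rule card_Un_disjoint) (use assms in auto)
  moreover have "card (Z \<inter> C \<union> Z \<inter> T \<union> Z \<inter> D) = card (Z \<inter> C \<union> Z \<inter> T) + card (Z \<inter> D)"
    by (rule card_Un_disjoint) (use assms in auto)
  moreover have "Z \<inter> C \<union> Z \<inter> T \<union> Z \<inter> D = Z" using assms by auto
  ultimately show ?thesis by simp
qed

lemma card_Un3_le: "card (A \<union> B \<union> C) \<le> card A + card B + card C"
  by (metis add_le_mono1 card_Un_le le_trans)

text \<open>
  The heart of Mader's theorem.  Two critical edges \<open>xa\<close> and \<open>ac\<close> at a vertex \<open>a\<close> of degree greater
  than \<open>k\<close> are given with their splits \<open>(A, S, X)\<close> and \<open>(C, T, D)\<close>, where \<open>a\<close> lies in \<open>A \<inter> D\<close>.  The two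
  splits cut the vertex set into nine cells.  The neighbours of a corner cell such as \<open>A \<inter> D\<close> are,
  apart from ends of the two edges, in the three cells of \<open>S \<union> T\<close> next to it, and the
  two such boundaries of opposite corners have at most \<open>card S + card T \<le> 2 * k - 2\<close> vertices in total.
  Hence a large boundary at one corner forces a small one at the opposite corner.  If \<open>A\<close> is no larger
  than \<open>X\<close> and than any side at \<open>c\<close> of a split of \<open>ca\<close>, this leaves too few neighbours for \<open>A \<inter> D\<close> or
  for \<open>a\<close>.
\<close>

lemma no_smallest_edge_split:
  assumes G: "simple_graph G" "k_connected k G"
    and split1: "edge_split k G A S X a x"
    and split2: "edge_split k G C T D c a"
    and "x \<noteq> c" and deg_a: "k < deg (edges G) a"
    and AX: "card A \<le> card X"
    and minimal: "\<And>P Q R. edge_split k G P Q R c a \<Longrightarrow> card A \<le> card P"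
  shows False
proof -
  have e2: "\<And>e. e \<in> edges G \<Longrightarrow> card e = 2" and eV: "\<And>p q. {p, q} \<in> edges G \<Longrightarrow> p \<in> verts G \<and> q \<in> verts G"
    using G(1) by (auto simp: simple_graph_def)
  have V1: "verts G = A \<union> S \<union> X" "A \<inter> S = {}" "A \<inter> X = {}" "S \<inter> X = {}" "a \<in> A" "x \<in> X" "card S < k"
    and E1: "\<And>p q. p \<in> A \<Longrightarrow> q \<in> X \<Longrightarrow> {p, q} \<in> edges G \<Longrightarrow> p = a \<and> q = x"
    using split1 by (auto simp: edge_split_def)
  have V2: "verts G = C \<union> T \<union> D" "C \<inter> T = {}" "C \<inter> D = {}" "T \<inter> D = {}" "c \<in> C" "a \<in> D" "card T < k"
    and E2: "\<And>p q. p \<in> C \<Longrightarrow> q \<in> D \<Longrightarrow> {p, q} \<in> edges G \<Longrightarrow> p = c \<and> q = a"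
    using split2 by (auto simp: edge_split_def)
  have E1': "\<And>p q. p \<in> X \<Longrightarrow> q \<in> A \<Longrightarrow> {p, q} \<in> edges G \<Longrightarrow> p = x \<and> q = a"
    using E1 by (metis insert_commute)
  have E2': "\<And>p q. p \<in> D \<Longrightarrow> q \<in> C \<Longrightarrow> {p, q} \<in> edges G \<Longrightarrow> p = a \<and> q = c"
    using E2 by (metis insert_commute)
  have "finite (verts G)" using G(1) by (simp add: simple_graph_def)
  then have "finite (A \<union> S \<union> X)" "finite (C \<union> T \<union> D)"
    using V1(1) V2(1) by metis+
  then have fin: "finite A" "finite S" "finite X" "finite C" "finite T" "finite D"
    by simp_all
  have cS: "card S = card (S \<inter> C) + card (S \<inter> T) + card (S \<inter> D)"
    using V1 V2 fin by (intro card_three_parts) auto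
  have cT: "card T = card (T \<inter> A) + card (T \<inter> S) + card (T \<inter> X)"
    using V1 V2 fin by (intro card_three_parts) auto
  have cA: "card A = card (A \<inter> C) + card (A \<inter> T) + card (A \<inter> D)"
    using V1 V2 fin by (intro card_three_parts) auto
  have nd: "(p \<in> A \<or> p \<in> S \<or> p \<in> X) \<and> (p \<in> C \<or> p \<in> T \<or> p \<in> D)" if "p \<in> verts G" for p
    using that V1(1) V2(1) by auto
  note comm = Int_commute[of T]
  define Q1 where "Q1 = A \<inter> T \<union> S \<inter> T \<union> S \<inter> D"
  have Q1: "card Q1 \<le> card (A \<inter> T) + card (S \<inter> T) + card (S \<inter> D)" "finite Q1"
    unfolding Q1_def using fin by (auto intro: card_Un3_le)
  have N1: "y \<in> A \<inter> D \<union> Q1 \<or> p = a \<and> y \<in> {x, c}"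
    if "p \<in> A \<inter> D" "{p, y} \<in> edges G" for p y
    using that nd[of y] eV[OF that(2)] E1[of p y] E2'[of p y] unfolding Q1_def by auto
  \<comment> \<open>No edge leaves \<open>X \<inter> C\<close> other than to its boundary \<open>Q2\<close>, so \<open>Q2\<close> would have at least \<open>k\<close> vertices
    and the boundary \<open>Q1\<close> of \<open>A \<inter> D\<close> at most \<open>k - 2\<close>.\<close>
  have XC: "X \<inter> C = {}"
  proof (rule ccontr)
    assume ne: "X \<inter> C \<noteq> {}"
    define Q2 where "Q2 = X \<inter> T \<union> S \<inter> T \<union> S \<inter> C"
    have Q2: "card Q2 \<le> card (X \<inter> T) + card (S \<inter> T) + card (S \<inter> C)" "finite Q2"
      unfolding Q2_def using fin by (auto intro: card_Un3_le)
    have N2: "y \<in> X \<inter> C \<union> Q2" if "p \<in> X \<inter> C" "{p, y} \<in> edges G" for p y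
      using that nd[of y] eV[OF that(2)] E1'[of p y] E2[of p y] V1(2-6) V2(2-6) \<open>x \<noteq> c\<close>
        unfolding Q2_def by auto
    have "k \<le> card Q2"
      by (rule k_le_card_if_separating[OF G, of "X \<inter> C" Q2 a])
        (use ne Q2 N2 V1 V2 in \<open>auto simp: Q2_def\<close>)
    then have small: "card Q1 + 2 \<le> k"
      using Q1 Q2 cS cT V1(7) V2(7) by (simp add: comm)
    show False
    proof (cases "A \<inter> D = {a}")
      case True
      have "deg (edges G) a \<le> card (Q1 \<union> {x, c})"
      proof (rule deg_le_card_neighbours)
        show "y \<in> Q1 \<union> {x, c}" if "{a, y} \<in> edges G" for y
          using N1[of a y] that True e2[OF that] by auto
      qed (use Q1 e2 in auto)
      also have "\<dots> \<le> card Q1 + card {x, c}" by (rule card_Un_le)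
      also have "\<dots> \<le> k" using small \<open>x \<noteq> c\<close> by simp
      finally show False using deg_a by simp
    next
      case False
      obtain z where z: "z \<in> X \<inter> C" using ne by blast
      have "k \<le> card (insert a Q1)"
        by (rule k_le_card_if_separating[OF G, of "A \<inter> D - {a}" _ z])
          (use False Q1 N1 V1 V2 z in \<open>auto simp: Q1_def\<close>)
      also have "\<dots> \<le> card Q1 + 1" using Q1 by (simp add: card_insert_if)
      finally show False using small by simp
    qed
  qed
  \<comment> \<open>With \<open>X \<inter> C\<close> empty, much of \<open>C\<close> has to lie in \<open>S\<close>: all of it if \<open>A \<inter> C\<close> is empty as well, and
    otherwise because \<open>A \<inter> C\<close> has a large boundary.\<close>
  have SC: "card A \<le> card (S \<inter> C)"
  proof (cases "A \<inter> C = {}")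
    case True
    then have "S \<inter> C = C" using XC V1(1) V2(1) by blast
    then show ?thesis using minimal[OF split2] by simp
  next
    case False
    define Q3 where "Q3 = A \<inter> T \<union> S \<inter> T \<union> S \<inter> C"
    have Q3: "card Q3 \<le> card (A \<inter> T) + card (S \<inter> T) + card (S \<inter> C)" "finite Q3"
      unfolding Q3_def using fin by (auto intro: card_Un3_le)
    have N3: "y \<in> A \<inter> C \<union> Q3 \<or> p = c \<and> y = a" if "p \<in> A \<inter> C" "{p, y} \<in> edges G" for p y
      using that nd[of y] eV[OF that(2)] E1[of p y] E2[of p y] V1(2-6) V2(2-6)
        unfolding Q3_def by auto
    have Q3V: "Q3 \<subseteq> verts G" unfolding Q3_def using V1(1) by blast
    have aout: "a \<notin> C" "a \<notin> Q3"
      unfolding Q3_def using V1(2,5) V2(3,4,6) by blast+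
    \<comment> \<open>Otherwise \<open>A \<inter> C\<close> is a side of a split of \<open>ca\<close>, and it misses the vertex \<open>a\<close> of \<open>A\<close>.\<close>
    have big: "k \<le> card Q3"
    proof (rule ccontr)
      assume "\<not> k \<le> card Q3"
      show False
      proof (cases "c \<in> A")
        case True
        have "edge_split k G (A \<inter> C) Q3 (verts G - A \<inter> C - Q3) c a"
          unfolding edge_split_def
        proof (intro conjI ballI impI)
          fix p q assume pq: "p \<in> A \<inter> C" "q \<in> verts G - A \<inter> C - Q3" "{p, q} \<in> edges G"
          then show "p = c" "q = a" using N3[of p q] by auto
        next
          show "verts G = A \<inter> C \<union> Q3 \<union> (verts G - A \<inter> C - Q3)"
            using Q3V V1(1) by blast
          show "A \<inter> C \<inter> Q3 = {}" unfolding Q3_def using V1(2) V2(2) by blast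
          show "a \<in> verts G - A \<inter> C - Q3" using aout V1(1,5) by blast
        qed (use True \<open>\<not> k \<le> card Q3\<close> V2(5) in auto)
        then have "card A \<le> card (A \<inter> C)" by (rule minimal)
        moreover have "A \<inter> C \<subset> A" using V1(5) aout(1) by blast
        ultimately show False using psubset_card_mono[OF fin(1), of "A \<inter> C"] by linarith
      next
        case False
        have "k \<le> card Q3"
        proof (rule k_le_card_if_separating[OF G])
          show "A \<inter> C \<subseteq> verts G" using V1(1) by blast
          show "y \<in> A \<inter> C \<union> Q3" if "p \<in> A \<inter> C" "{p, y} \<in> edges G" for p y
            using N3[OF that] that False by blast
          show "a \<in> verts G" "a \<notin> A \<inter> C" "a \<notin> Q3" using V1(1,5) aout by blast+
        qed (use \<open>A \<inter> C \<noteq> {}\<close> Q3 in auto)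
        then show False using \<open>\<not> k \<le> card Q3\<close> by simp
      qed
    qed
    have XD: "X \<inter> D = {}"
    proof (rule ccontr)
      assume ne: "X \<inter> D \<noteq> {}"
      define Q4 where "Q4 = X \<inter> T \<union> S \<inter> T \<union> S \<inter> D"
      have Q4: "card Q4 \<le> card (X \<inter> T) + card (S \<inter> T) + card (S \<inter> D)" "finite Q4"
        unfolding Q4_def using fin by (auto intro: card_Un3_le)
      have N4: "y \<in> X \<inter> D \<union> insert a Q4" if "p \<in> X \<inter> D" "{p, y} \<in> edges G" for p y
        using that nd[of y] eV[OF that(2)] E1'[of p y] E2'[of p y] V1(2-6) V2(2-6)
        unfolding Q4_def by auto
      obtain z where z: "z \<in> A \<inter> C" using False by blast
      have "k \<le> card (insert a Q4)"
        by (rule k_le_card_if_separating[OF G, of "X \<inter> D" _ z])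
          (use ne Q4 N4 V1 V2 z in \<open>auto simp: Q4_def\<close>)
      also have "\<dots> \<le> card Q4 + 1" using Q4 by (simp add: card_insert_if)
      finally show False using big Q3 Q4 cS cT V1(7) V2(7) by (simp add: comm)
    qed
    have "X \<inter> T = X" using XC XD V1(1) V2(1) by blast
    then have "card (S \<inter> C) \<ge> card X"
      using big Q3 cT V2(7) by (simp add: comm)
    then show ?thesis using AX by simp
  qed
  \<comment> \<open>So few vertices of \<open>S\<close> are left for the boundary of \<open>A \<inter> D\<close> that either \<open>A \<inter> D\<close> consists of \<open>a\<close>
    alone, whose degree is then at most \<open>k\<close>, or fewer than \<open>k\<close> vertices cut \<open>A \<inter> D\<close> off.\<close>
  have bound: "card (Q1 \<union> {x, c}) + card (A \<inter> D) \<le> k + 1"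
  proof -
    have "card (Q1 \<union> {x, c}) \<le> card Q1 + card {x, c}" by (rule card_Un_le)
    then show ?thesis using Q1 cS cA SC V1(7) \<open>x \<noteq> c\<close> by (simp)
  qed
  have aAD: "a \<in> A \<inter> D" using V1 V2 by simp
  show False
  proof (cases "A \<inter> D = {a}")
    case True
    have "deg (edges G) a \<le> card (Q1 \<union> {x, c})"
    proof (rule deg_le_card_neighbours)
      show "y \<in> Q1 \<union> {x, c}" if "{a, y} \<in> edges G" for y
        using N1[of a y] that True e2[OF that] by auto
    qed (use Q1 e2 in auto)
    then show False using bound True deg_a by simp
  next
    case False
    then have "{a} \<subset> A \<inter> D" using aAD by blast
    then have two: "2 \<le> card (A \<inter> D)"
      using psubset_card_mono[of "A \<inter> D" "{a}"] fin by simp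
    have "card (A \<inter> D) \<le> card A" using fin by (intro card_mono) auto
    then have "X \<noteq> {x}" using two AX by auto
    then obtain z where z: "z \<in> X" "z \<noteq> x" using V1 by blast
    have "k \<le> card (Q1 \<union> {x, c})"
      by (rule k_le_card_if_separating[OF G, of "A \<inter> D" _ z])
        (use z aAD Q1 N1 V1 V2 XC in \<open>auto simp: Q1_def\<close>)
    then show False using bound two by simp
  qed
qed

text \<open>Among all splits of edges of \<open>H\<close>, in both directions, choose one with a smallest side.  If the end \<open>a\<close>
  in this side lay on a second edge of \<open>H\<close>, the previous lemma would apply.\<close>

lemma mader_critical_edges:
  assumes G: "simple_graph G" "k_connected k G"
    and H: "H \<subseteq> edges G" "H \<noteq> {}"
    and crit: "\<And>e. e \<in> H \<Longrightarrow> \<not> k_connected k (delete_edges G {e})"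
    and deg: "\<And>v. v \<in> \<Union>H \<Longrightarrow> k < deg (edges G) v"
  shows "\<exists>v. deg H v = 1"
proof (rule ccontr)
  assume no: "\<not> ?thesis"
  have e2: "\<And>e. e \<in> edges G \<Longrightarrow> card e = 2"
    using G(1) by (auto simp: simple_graph_def)
  define good where "good n \<longleftrightarrow> (\<exists>A S X a x. {a, x} \<in> H \<and> edge_split k G A S X a x \<and> card A = n)" for n
  obtain e where "e \<in> H" using H by blast
  then have "card e = 2" using e2 H by blast
  then obtain p q where "e = {p, q}" by (auto simp: card_2_iff)
  then have pq: "{p, q} \<in> H" using \<open>e \<in> H\<close> by simp
  have "\<exists>n. good n" unfolding good_def
    using critical_edge_split[OF G crit[OF pq]] pq by blast
  then have "good (LEAST n. good n)" by (rule LeastI_ex)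
  then obtain A S X a x where ax: "{a, x} \<in> H" and s1: "edge_split k G A S X a x"
    and cA: "card A = (LEAST n. good n)" unfolding good_def by blast
  have least: "card A \<le> card P" if "edge_split k G P Q R b y" "{b, y} \<in> H" for P Q R b y
  proof -
    have "good (card P)" unfolding good_def using that by blast
    then show ?thesis unfolding cA by (rule Least_le)
  qed
  have "\<exists>e'\<in>H. a \<in> e' \<and> e' \<noteq> {a, x}"
  proof (rule ccontr)
    assume "\<not> ?thesis"
    then have "{e \<in> H. a \<in> e} = {{a, x}}" using ax by blast
    then have "deg H a = 1" by (simp add: deg_def)
    then show False using no by blast
  qed
  then obtain e' where e': "e' \<in> H" "a \<in> e'" "e' \<noteq> {a, x}" by blast
  then have "card e' = 2" using e2 H by blast
  then obtain p' q' where "e' = {p', q'}" by (auto simp: card_2_iff)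
  then have "e' = {p', a} \<or> e' = {q', a}" using e'(2) by blast
  then obtain c where c: "e' = {c, a}" by blast
  then have "c \<noteq> x" using e'(3) by (metis insert_commute)
  have cH: "{c, a} \<in> H" using e' c by simp
  then obtain C T D where s2: "edge_split k G C T D c a"
    using critical_edge_split[OF G crit] by blast
  show False
  proof (rule no_smallest_edge_split[OF G s1 s2])
    show "x \<noteq> c" using \<open>c \<noteq> x\<close> by simp
    show "k < deg (edges G) a" using deg ax by blast
    show "card A \<le> card X"
      using least[OF edge_split_sym[OF s1]] ax by (metis insert_commute)
    show "card A \<le> card P" if "edge_split k G P Q R c a" for P Q R
      by (rule least[OF that cH])
  qed
qed

section \<open>Forests and their leaves\<close>

lemma deg_remove_edge:
  assumes "finite H" "e \<in> H"
  shows "deg H v = deg (H - {e}) v + (if v \<in> e then 1 else 0)"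
proof (cases "v \<in> e")
  case True
  then have "{d \<in> H. v \<in> d} = insert e {d \<in> H - {e}. v \<in> d}" using assms by auto
  then show ?thesis using True assms by (simp add: deg_def)
next
  case False
  then have "{d \<in> H. v \<in> d} = {d \<in> H - {e}. v \<in> d}" by auto
  then show ?thesis using False by (simp add: deg_def)
qed

text \<open>For finite sets of edges this is acyclicity, in the form in which Mader's theorem provides it.\<close>

definition forest :: "'a set set \<Rightarrow> bool" where
  "forest F \<longleftrightarrow> (\<forall>H\<subseteq>F. H \<noteq> {} \<longrightarrow> (\<exists>v. deg H v = 1))"

definition leaves :: "'a set set \<Rightarrow> 'a set" where
  "leaves H = {v. deg H v = 1}"

lemma forest_subset: "forest F \<Longrightarrow> H \<subseteq> F \<Longrightarrow> forest H"
  by (auto simp: forest_def)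

lemma leaves_subset: "leaves H \<subseteq> \<Union>H"
proof
  fix v assume "v \<in> leaves H"
  then have "card {e \<in> H. v \<in> e} \<noteq> 0" by (simp add: leaves_def deg_def)
  then have "{e \<in> H. v \<in> e} \<noteq> {}" by (metis card.empty)
  then show "v \<in> \<Union>H" by auto
qed

lemma finite_leaves:
  assumes "finite H" "\<And>e. e \<in> H \<Longrightarrow> card e = 2"
  shows "finite (leaves H)"
proof -
  have "finite e" if "e \<in> H" for e
    using assms(2)[OF that] by (simp add: card_ge_0_finite)
  then have "finite (\<Union>H)" using assms(1) by blast
  then show ?thesis using leaves_subset finite_subset by metis
qed

text \<open>Prune a leaf \<open>p\<close> with neighbour \<open>q\<close>.  Putting it back creates the leaf \<open>p\<close> and destroys at most the
  leaf \<open>q\<close>, so the number of leaves does not decrease; it grows unless \<open>q\<close> was a leaf, which makes up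
  for the larger degree of \<open>q\<close>.\<close>

lemma forest_leaves:
  assumes "finite H" "\<And>e. e \<in> H \<Longrightarrow> card e = 2" "forest H" "H \<noteq> {}"
  shows "2 \<le> card (leaves H) \<and> (\<forall>x. deg H x \<le> card (leaves H))"
  using assms
proof (induction rule: finite_psubset_induct)
  case (psubset H)
  obtain p where p: "deg H p = 1" using psubset.prems(2,3) by (auto simp: forest_def)
  then obtain e where e: "{d \<in> H. p \<in> d} = {e}" by (auto simp: deg_def card_1_singleton_iff)
  then have eH: "e \<in> H" "p \<in> e" by auto
  then obtain q where q: "e = {p, q}" "p \<noteq> q"
    using psubset.prems(1)[of e] by (auto simp: card_2_iff)
  define H' where "H' = H - {e}"
  have degH: "deg H x = deg H' x + (if x = p \<or> x = q then 1 else 0)" for x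
    using deg_remove_edge[OF psubset.hyps eH(1), of x] q by (auto simp: H'_def)
  have finL: "finite (leaves H)"
    by (rule finite_leaves) (use psubset in auto)
  show ?case
  proof (cases "H' = {}")
    case True
    then have "leaves H = {p, q}" "\<And>x. deg H x \<le> 1"
      using degH by (auto simp: leaves_def deg_def)
    then show ?thesis using q by (simp add: le_SucI)
  next
    case False
    have "H' \<subset> H" using eH by (auto simp: H'_def)
    then have IH: "2 \<le> card (leaves H')" "\<And>x. deg H' x \<le> card (leaves H')"
      using psubset.IH[of H'] psubset.prems(1,2) False forest_subset[of H H'] by auto
    have finL': "finite (leaves H')" using IH(1) by (metis card.infinite not_numeral_le_zero)
    have p': "deg H' p = 0" using degH[of p] p by simp
    have "insert p (leaves H' - {q}) \<subseteq> leaves H"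
      using degH p' by (auto simp: leaves_def)
    then have "card (insert p (leaves H' - {q})) \<le> card (leaves H)"
      using finL card_mono by blast
    moreover have "card (insert p (leaves H' - {q})) = card (leaves H' - {q}) + 1"
      using finL' p' by (simp add: leaves_def)
    ultimately have L: "card (leaves H' - {q}) + 1 \<le> card (leaves H)" by simp
    then have L1: "card (leaves H') \<le> card (leaves H)"
      using card_Diff_singleton_if[of "leaves H'" q] by (auto split: if_splits)
    have "deg H x \<le> card (leaves H)" for x
    proof (cases "x = q")
      case True
      show ?thesis
      proof (cases "q \<in> leaves H'")
        case True
        then show ?thesis using \<open>x = q\<close> degH[of q] L1 IH(1) by (simp add: leaves_def)
      next
        case False
        then show ?thesis using L IH(2)[of q] degH[of q] \<open>x = q\<close> by simp
      qed
    next
      case False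
      then show ?thesis using degH[of x] p' IH(2)[of x] L1 IH(1) by (cases "x = p") auto
    qed
    then show ?thesis using L1 IH(1) by simp
  qed
qed

section \<open>Connected graphs with all degrees equal to 2\<close>

lemma deg_eq_card_neighbours:
  assumes "simple_graph G"
  shows "deg (edges G) v = card {y. {v, y} \<in> edges G}"
proof -
  have "bij_betw (\<lambda>y. {v, y}) {y. {v, y} \<in> edges G} {e \<in> edges G. v \<in> e}"
  proof (rule bij_betwI')
    fix e assume e: "e \<in> {e \<in> edges G. v \<in> e}"
    then have "card e = 2" using assms by (auto simp: simple_graph_def)
    then obtain p q where "e = {p, q}" by (auto simp: card_2_iff)
    then have "e = {v, p} \<or> e = {v, q}" using e by auto
    then show "\<exists>y\<in>{y. {v, y} \<in> edges G}. e = {v, y}" using e by blast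
  qed (auto simp: doubleton_eq_iff)
  then show ?thesis by (simp add: deg_def bij_betw_same_card)
qed

lemma finite_neighbours:
  assumes "simple_graph G"
  shows "finite {y. {v, y} \<in> edges G}"
proof -
  have "{y. {v, y} \<in> edges G} \<subseteq> verts G" using assms by (auto simp: simple_graph_def)
  then show ?thesis using assms finite_subset by (auto simp: simple_graph_def)
qed

text \<open>Take a longest path.  All neighbours of its first vertex lie on it; the one other than the second
  vertex of the path can only be the last vertex, since the inner vertices already have their two
  neighbours on the path.  The resulting cycle is closed under taking neighbours and thus is everything.\<close>

lemma connected_two_regular_is_cycle:
  fixes G :: "'a graph"
  assumes G: "simple_graph G" "k_connected 1 G"
    and two: "\<And>v. v \<in> verts G \<Longrightarrow> deg (edges G) v = 2"
  shows "is_cycle G"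
proof -
  have finV: "finite (verts G)" using G(1) by (simp add: simple_graph_def)
  have eV: "p \<in> verts G" "q \<in> verts G" "p \<noteq> q" if "{p, q} \<in> edges G" for p q
  proof -
    have "{p, q} \<subseteq> verts G \<and> card {p, q} = 2" using that G(1) unfolding simple_graph_def by blast
    then show "p \<in> verts G" "q \<in> verts G" "p \<noteq> q" by auto
  qed
  have N: "w \<in> {y, z}" if "{v, y} \<in> edges G" "{v, z} \<in> edges G" "{v, w} \<in> edges G" "y \<noteq> z" for v w y z
  proof -
    have "card {y. {v, y} \<in> edges G} = 2"
      using deg_eq_card_neighbours[OF G(1)] two[OF eV(1)[OF that(1)]] by metis
    then have "{y, z} = {y. {v, y} \<in> edges G}"
      using that by (intro card_seteq[OF finite_neighbours[OF G(1)]]) auto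
    then show ?thesis using that by blast
  qed
  define path where "path ps \<longleftrightarrow> distinct ps \<and> set ps \<subseteq> verts G \<and> ps \<noteq> [] \<and>
    (\<forall>i. Suc i < length ps \<longrightarrow> {ps ! i, ps ! Suc i} \<in> edges G)" for ps
  obtain v0 where v0: "v0 \<in> verts G" using G(2) by (fastforce simp: k_connected_def)
  have "path [v0]" using v0 by (simp add: path_def)
  moreover have "\<forall>ps. path ps \<longrightarrow> length ps \<le> card (verts G)"
    by (metis path_def card_mono distinct_card finV)
  ultimately obtain ps where ps: "path ps" "\<And>qs. path qs \<Longrightarrow> length qs \<le> length ps"
    using ex_has_greatest_nat[of path "[v0]" length "Suc (card (verts G))"]
    by (metis le_imp_less_Suc)
  define n where "n = length ps"
  have dist: "distinct ps" and sub: "set ps \<subseteq> verts G" and ne: "ps \<noteq> []"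
    and adj: "\<And>i. Suc i < n \<Longrightarrow> {ps ! i, ps ! Suc i} \<in> edges G"
    using ps(1) by (auto simp: path_def n_def)
  have n0: "0 < n" using ne by (simp add: n_def)
  have end0: "y \<in> set ps" if y: "{ps ! 0, y} \<in> edges G" for y
  proof (rule ccontr)
    assume "y \<notin> set ps"
    have "path (y # ps)"
      unfolding path_def
    proof (intro conjI allI impI)
      fix i assume "Suc i < length (y # ps)"
      then show "{(y # ps) ! i, (y # ps) ! Suc i} \<in> edges G"
        using adj[of "i - 1"] y by (cases i) (auto simp: n_def insert_commute)
    qed (use dist sub \<open>y \<notin> set ps\<close> eV[OF y] in auto)
    then show False using ps(2)[of "y # ps"] by simp
  qed
  have "ps ! 0 \<in> verts G" using sub n0 by (auto simp: n_def)
  then have "card {y. {ps ! 0, y} \<in> edges G} = 2"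
    using two deg_eq_card_neighbours[OF G(1)] by metis
  then obtain y z where yz: "{y. {ps ! 0, y} \<in> edges G} = {y, z}" "y \<noteq> z"
    by (auto simp: card_2_iff)
  have "\<exists>j. 2 \<le> j \<and> j < n \<and> {ps ! 0, ps ! j} \<in> edges G"
  proof -
    have far: "\<exists>j. 2 \<le> j \<and> j < n \<and> {ps ! 0, ps ! j} \<in> edges G"
      if a: "{ps ! 0, a} \<in> edges G" "a \<noteq> ps ! 1" for a
    proof -
      obtain j where j: "j < n" "a = ps ! j"
        using end0[OF a(1)] by (auto simp: in_set_conv_nth n_def)
      moreover have "j \<noteq> 0" using eV(3)[OF a(1)] j by metis
      moreover have "j \<noteq> 1" using a j by metis
      ultimately show ?thesis using a by (intro exI[of _ j]) auto
    qed
    show ?thesis using far[of y] far[of z] yz by blast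
  qed
  then obtain j where j: "2 \<le> j" "j < n" "{ps ! 0, ps ! j} \<in> edges G" by blast
  have inj: "ps ! i = ps ! l \<longleftrightarrow> i = l" if "i < n" "l < n" for i l
    using nth_eq_iff_index_eq[OF dist] that by (simp add: n_def)
  have jn: "Suc j = n"
  proof (rule ccontr)
    assume "Suc j \<noteq> n"
    then have "Suc j < n" using j by simp
    moreover have "{ps ! j, ps ! (j - 1)} \<in> edges G"
      using adj[of "j - 1"] j by (simp add: insert_commute)
    moreover have "{ps ! j, ps ! 0} \<in> edges G" using j by (simp add: insert_commute)
    ultimately have "ps ! 0 \<in> {ps ! (j - 1), ps ! Suc j}"
      using adj[of j] inj[of "j - 1" "Suc j"] by (intro N[of "ps ! j"]) auto
    moreover have "0 \<noteq> j - 1" "j - 1 < n" using j by auto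
    ultimately show False using inj[of 0 "j - 1"] inj[of 0 "Suc j"] n0 \<open>Suc j < n\<close> by blast
  qed
  have cyc: "{ps ! i, ps ! (Suc i mod n)} \<in> edges G" if "i < n" for i
  proof (cases "Suc i < n")
    case True then show ?thesis using adj by simp
  next
    case False
    then have "i = j" "Suc i = n" using that jn by auto
    then show ?thesis using j by (simp add: insert_commute)
  qed
  \<comment> \<open>The cyclic predecessor of an index; the last index is \<open>j\<close>.\<close>
  define pre where "pre i = (if i = 0 then j else i - 1)" for i
  have pre: "pre i < n \<and> Suc (pre i) mod n = i \<and> pre i \<noteq> Suc i mod n" if "i < n" for i
  proof (cases "i = 0")
    case True
    then have "Suc i mod n = 1" using j by simp
    then show ?thesis using True j jn by (simp add: pre_def)
  next
    case False
    then have p: "pre i = i - 1" "Suc (i - 1) = i" by (auto simp: pre_def)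
    have "i - 1 \<noteq> Suc i mod n"
    proof (cases "Suc i = n")
      case True
      then show ?thesis using jn j by simp
    next
      case False
      then show ?thesis using that by simp
    qed
    then show ?thesis using p that by simp
  qed
  have nb: "w \<in> {ps ! pre i, ps ! (Suc i mod n)}" if "i < n" "{ps ! i, w} \<in> edges G" for i w
  proof (rule N[OF _ _ that(2)])
    have p: "pre i < n" "Suc (pre i) mod n = i" "pre i \<noteq> Suc i mod n" "Suc i mod n < n"
      using pre[OF that(1)] n0 by simp_all
    show "{ps ! i, ps ! pre i} \<in> edges G"
      using cyc[OF p(1)] unfolding p(2) by (simp only: insert_commute)
    show "{ps ! i, ps ! (Suc i mod n)} \<in> edges G" by (rule cyc[OF that(1)])
    show "ps ! pre i \<noteq> ps ! (Suc i mod n)" using inj[OF p(1,4)] p(3) by blast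
  qed
  have closed: "w \<in> set ps" if vw: "v \<in> set ps" "{v, w} \<in> edges G" for v w
  proof -
    obtain i where i: "i < n" "v = ps ! i" using vw(1) unfolding n_def by (metis in_set_conv_nth)
    have "w \<in> {ps ! pre i, ps ! (Suc i mod n)}" using nb[OF i(1), of w] vw(2) unfolding i(2) by simp
    moreover have "pre i < length ps" "Suc i mod n < length ps"
      using conjunct1[OF pre[OF i(1)]] n0 mod_less_divisor[of n "Suc i"] unfolding n_def by blast+
    then have "ps ! pre i \<in> set ps" "ps ! (Suc i mod n) \<in> set ps" by simp_all
    ultimately show ?thesis by blast
  qed
  have all: "set ps = verts G"
  proof (rule ccontr)
    assume "set ps \<noteq> verts G"
    then have "separation G (set ps) {} (verts G - set ps)"
      using sub ne closed by (auto simp: separation_def)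
    then have "1 \<le> card ({} :: 'a set)"
      using G(2) k_connected_iff_separation[OF G(1)] by blast
    then show False by simp
  qed
  have "edges G = {{ps ! i, ps ! (Suc i mod n)} | i. i < n}"
  proof
    show "edges G \<subseteq> {{ps ! i, ps ! (Suc i mod n)} | i. i < n}"
    proof
      fix e assume e: "e \<in> edges G"
      then have "card e = 2" using G(1) by (auto simp: simple_graph_def)
      then obtain v w where vw: "e = {v, w}" by (auto simp: card_2_iff)
      then have "v \<in> set ps" using eV e all by blast
      then obtain i where i: "i < n" "v = ps ! i" unfolding n_def by (metis in_set_conv_nth)
      have "w = ps ! pre i \<or> w = ps ! (Suc i mod n)" using nb[OF i(1), of w] e unfolding vw i(2) by simp
      then show "e \<in> {{ps ! i, ps ! (Suc i mod n)} | i. i < n}"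
      proof
        assume "w = ps ! pre i"
        then have "e = {ps ! pre i, ps ! (Suc (pre i) mod n)}"
          using vw i pre[OF i(1)] by (metis insert_commute)
        then show ?thesis using pre[OF i(1)] by blast
      next
        assume "w = ps ! (Suc i mod n)"
        then show ?thesis using vw i by blast
      qed
    qed
  qed (use cyc in blast)
  then show ?thesis
    unfolding is_cycle_def using dist all j by (intro exI[of _ ps]) (auto simp: n_def)
qed

section \<open>Exchanging the edge uv\<close>

lemma two_elements:
  assumes "2 \<le> card A"
  obtains a b where "a \<in> A" "b \<in> A" "a \<noteq> b"
proof -
  have "\<not> (\<forall>a\<in>A. \<forall>b\<in>A. a = b)"
    using assms by (metis card_le_Suc0_iff_eq card.infinite not_less_eq_eq numeral_2_eq_2 le0)
  then show ?thesis using that by blast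
qed

text \<open>The situation left by Mader's theorem: the edges that avoid a fixed edge \<open>uv\<close> form a forest.\<close>

locale edge_with_forest =
  fixes G :: "'a graph" and u v :: 'a
  assumes simple: "simple_graph G"
    and uv: "{u, v} \<in> edges G"
    and forest: "forest {e \<in> edges G. e \<inter> {u, v} = {}}"
begin

definition F :: "'a set set" where
  "F = {e \<in> edges G. e \<inter> {u, v} = {}}"

definition W :: "'a set" where
  "W = verts G - {u, v}"

lemma card_edge: "e \<in> edges G \<Longrightarrow> card e = 2"
  using simple by (auto simp: simple_graph_def)

lemma edge_verts: "{p, q} \<in> edges G \<Longrightarrow> p \<in> verts G \<and> q \<in> verts G \<and> p \<noteq> q"
proof -
  assume "{p, q} \<in> edges G"
  then have "{p, q} \<subseteq> verts G \<and> card {p, q} = 2"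
    using simple unfolding simple_graph_def by blast
  then show ?thesis by auto
qed

lemma u_neq_v: "u \<noteq> v" and u_vert: "u \<in> verts G" and v_vert: "v \<in> verts G"
  using edge_verts[OF uv] by auto

lemma finite_edges: "finite (edges G)"
proof -
  have "edges G \<subseteq> Pow (verts G)" using simple by (auto simp: simple_graph_def)
  then show ?thesis using simple finite_subset by (auto simp: simple_graph_def)
qed

lemma F_sub: "F \<subseteq> edges G" and finite_F: "finite F" and card_F: "e \<in> F \<Longrightarrow> card e = 2"
  using finite_edges card_edge by (auto simp: F_def)

lemma F_verts: "e \<in> F \<Longrightarrow> e \<subseteq> W"
  using simple by (auto simp: F_def W_def simple_graph_def)

lemma deg_split:
  assumes "z \<in> W"
  shows "deg (edges G) z =
    deg F z + (if {u, z} \<in> edges G then 1 else 0) + (if {v, z} \<in> edges G then 1 else 0)"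
proof -
  define Au where "Au = (if {u, z} \<in> edges G then {{u, z}} else {})"
  define Av where "Av = (if {v, z} \<in> edges G then {{v, z}} else {})"
  have z: "z \<noteq> u" "z \<noteq> v" using assms by (auto simp: W_def)
  have "{e \<in> edges G. z \<in> e} = {e \<in> F. z \<in> e} \<union> (Au \<union> Av)"
  proof
    show "{e \<in> edges G. z \<in> e} \<subseteq> {e \<in> F. z \<in> e} \<union> (Au \<union> Av)"
    proof
      fix e assume e: "e \<in> {e \<in> edges G. z \<in> e}"
      then have "card e = 2" using card_edge by blast
      then obtain p q where "e = {p, q}" by (auto simp: card_2_iff)
      then have "e = {p, z} \<or> e = {q, z}" using e by blast
      then obtain y where y: "e = {y, z}" by blast
      consider "y = u" | "y = v" | "y \<noteq> u" "y \<noteq> v" by blast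
      then show "e \<in> {e \<in> F. z \<in> e} \<union> (Au \<union> Av)"
      proof cases
        case 1
        then have "e \<in> Au" using e y by (simp add: Au_def)
        then show ?thesis by blast
      next
        case 2
        then have "e \<in> Av" using e y by (simp add: Av_def)
        then show ?thesis by blast
      next
        case 3
        then have "e \<in> F" using e y z by (simp add: F_def)
        then show ?thesis using e by blast
      qed
    qed
    show "{e \<in> F. z \<in> e} \<union> (Au \<union> Av) \<subseteq> {e \<in> edges G. z \<in> e}"
      by (auto simp: F_def Au_def Av_def split: if_splits)
  qed
  then have "deg (edges G) z = card ({e \<in> F. z \<in> e} \<union> (Au \<union> Av))" by (simp add: deg_def)
  also have "\<dots> = deg F z + card (Au \<union> Av)"
    unfolding deg_def
  proof (rule card_Un_disjoint)
    show "finite {e \<in> F. z \<in> e}" using finite_F by simp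
    show "finite (Au \<union> Av)" by (simp add: Au_def Av_def)
    show "{e \<in> F. z \<in> e} \<inter> (Au \<union> Av) = {}" by (auto simp: F_def Au_def Av_def split: if_splits)
  qed
  also have "card (Au \<union> Av) = card Au + card Av"
    by (rule card_Un_disjoint) (use u_neq_v z in \<open>auto simp: Au_def Av_def doubleton_eq_iff\<close>)
  finally show ?thesis by (simp add: Au_def Av_def)
qed

text \<open>The leaves of the forest formed by the edges that meet \<open>X\<close> are leaves of \<open>F\<close> or lie in \<open>S\<close>.  Thus a
  piece of \<open>F\<close> that a small set \<open>S\<close> cuts off still contains leaves of \<open>F\<close>.\<close>

lemma leaves_meeting:
  assumes "finite S" and meet: "\<And>e. e \<in> F \<Longrightarrow> e \<inter> X \<noteq> {} \<Longrightarrow> e \<subseteq> X \<union> S"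
    and y: "y \<in> X" "deg F y \<noteq> 0"
  shows "2 \<le> card (leaves F \<inter> X) + card S"
    and "z \<in> X \<Longrightarrow> deg F z \<le> card (leaves F \<inter> X) + card S"
proof -
  define H where "H = {e \<in> F. e \<inter> X \<noteq> {}}"
  have HF: "H \<subseteq> F" by (auto simp: H_def)
  have degH: "deg H z = deg F z" if "z \<in> X" for z
  proof -
    have "{e \<in> H. z \<in> e} = {e \<in> F. z \<in> e}" using that by (auto simp: H_def)
    then show ?thesis by (simp add: deg_def)
  qed
  have "H \<noteq> {}" using y degH[of y] by (auto simp: deg_def)
  moreover have "forest H" using forest HF forest_subset unfolding F_def by blast
  ultimately have L: "2 \<le> card (leaves H)" "\<And>x. deg H x \<le> card (leaves H)"
    using forest_leaves[of H] HF finite_F card_F finite_subset by blast+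
  have "leaves H \<subseteq> X \<union> S"
    using leaves_subset[of H] meet by (fastforce simp: H_def)
  then have "leaves H \<subseteq> (leaves F \<inter> X) \<union> S" using degH by (auto simp: leaves_def)
  moreover have "finite (leaves F)" using finite_leaves finite_F card_F by blast
  ultimately have "card (leaves H) \<le> card ((leaves F \<inter> X) \<union> S)"
    using \<open>finite S\<close> by (intro card_mono) auto
  also have "\<dots> \<le> card (leaves F \<inter> X) + card S" by (rule card_Un_le)
  finally have le: "card (leaves H) \<le> card (leaves F \<inter> X) + card S" .
  show "2 \<le> card (leaves F \<inter> X) + card S" using le L by simp
  show "deg F z \<le> card (leaves F \<inter> X) + card S" if "z \<in> X"
    using le L(2)[of z] degH[OF that] by simp
qed

lemma two_matching:
  assumes "w \<in> W" "w' \<in> W" "w \<noteq> w'" "{u, w} \<in> edges G" "{v, w'} \<in> edges G"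
  shows "l_matching 2 G {{u, w}, {v, w'}}"
  using assms u_neq_v
  by (auto simp: l_matching_def matching_def W_def card_2_iff doubleton_eq_iff)

text \<open>Since the edge \<open>uv\<close> is kept, \<open>u\<close> and \<open>v\<close> are never on different sides of a separation of the remaining
  graph, so one side \<open>X\<close> contains neither.  No edge of \<open>F\<close> is deleted, so within \<open>F\<close> the side \<open>X\<close> can be
  left only through \<open>S\<close>; edges of \<open>G\<close> that cross the separation are among the two deleted ones.\<close>

lemma separation_avoiding_uv:
  assumes w: "w \<in> W" "w' \<in> W"
    and card: "k < card (verts G)"
    and not: "\<not> k_connected k (delete_edges G {{u, w}, {v, w'}})"
  obtains A S X where "separation (delete_edges G {{u, w}, {v, w'}}) A S X"
    "card S < k" "finite S" "u \<notin> X" "v \<notin> X"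
    "\<And>e. e \<in> F \<Longrightarrow> e \<inter> X \<noteq> {} \<Longrightarrow> e \<subseteq> X \<union> (S - {u, v})"
    "X \<subseteq> W"
    "\<And>z. z \<in> X \<Longrightarrow> u \<in> A \<Longrightarrow> {u, z} \<in> edges G \<Longrightarrow> z = w"
    "\<And>z. z \<in> X \<Longrightarrow> v \<in> A \<Longrightarrow> {v, z} \<in> edges G \<Longrightarrow> z = w'"
proof -
  let ?M = "{{u, w}, {v, w'}}"
  let ?G' = "delete_edges G ?M"
  have wne: "w \<noteq> u" "w \<noteq> v" "w' \<noteq> u" "w' \<noteq> v" using w by (auto simp: W_def)
  have V: "verts ?G' = verts G" and E: "edges ?G' = edges G - ?M"
    by (simp_all add: delete_edges_def)
  obtain A0 S X0 where sep0: "separation ?G' A0 S X0" and S: "card S < k"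
    using not card k_connected_iff_separation[OF simple_graph_delete_edges[OF simple]] V
    by (metis not_le)
  have "{u, v} \<noteq> {u, w}" "{u, v} \<noteq> {v, w'}"
    using wne u_neq_v by (auto simp: doubleton_eq_iff)
  then have uvE: "{u, v} \<in> edges ?G'" "{v, u} \<in> edges ?G'"
    using uv unfolding E by (auto simp: insert_commute)
  have "\<exists>A X. separation ?G' A S X \<and> u \<notin> X \<and> v \<notin> X"
  proof (cases "u \<in> X0 \<or> v \<in> X0")
    case True
    have "A0 \<inter> X0 = {}" and cut: "\<forall>p\<in>A0. \<forall>q\<in>X0. {p, q} \<notin> edges ?G'"
      using sep0 unfolding separation_def by blast+
    then have "u \<notin> A0" "v \<notin> A0"
      using True uvE by blast+
    then show ?thesis using separation_sym[OF sep0] by blast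
  next
    case False
    then show ?thesis using sep0 by blast
  qed
  then obtain A X where sep: "separation ?G' A S X" and uX: "u \<notin> X" and vX: "v \<notin> X" by blast
  have parts: "verts G = A \<union> S \<union> X"
    using sep unfolding separation_def V by blast
  have nE: "{p, q} \<in> ?M" if "p \<in> A" "q \<in> X" "{p, q} \<in> edges G" for p q
  proof -
    have "{p, q} \<notin> edges ?G'" using sep that(1,2) unfolding separation_def by blast
    then show ?thesis using that(3) unfolding E by blast
  qed
  have finS: "finite S" using simple parts by (auto simp: simple_graph_def)
  have XW: "X \<subseteq> W" using parts uX vX by (auto simp: W_def)
  have "e \<subseteq> X \<union> (S - {u, v})" if e: "e \<in> F" "e \<inter> X \<noteq> {}" for e
  proof -
    obtain q where q: "q \<in> e" "q \<in> X" using e by blast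
    have "p \<in> X \<union> (S - {u, v})" if "p \<in> e" for p
    proof (rule ccontr)
      assume notin: "p \<notin> X \<union> (S - {u, v})"
      have pW: "p \<in> W" using F_verts e that by blast
      then have "p \<in> A" "p \<noteq> q" using notin parts q by (auto simp: W_def)
      have "card e = 2" using card_F e by blast
      then have "e = {p, q}" using q that \<open>p \<noteq> q\<close> by (auto simp: card_2_iff)
      then have "{p, q} \<in> ?M" using nE[OF \<open>p \<in> A\<close> q(2)] e F_sub by blast
      then show False using e \<open>e = {p, q}\<close> by (auto simp: F_def)
    qed
    then show ?thesis by blast
  qed
  moreover have "z = w" if "z \<in> X" "u \<in> A" "{u, z} \<in> edges G" for z
    using nE[OF that(2,1,3)] u_neq_v wne by (auto simp: doubleton_eq_iff)
  moreover have "z = w'" if "z \<in> X" "v \<in> A" "{v, z} \<in> edges G" for z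
    using nE[OF that(2,1,3)] u_neq_v wne by (auto simp: doubleton_eq_iff)
  ultimately show ?thesis using that[OF sep S finS uX vX _ XW] by blast
qed

text \<open>All leaves of \<open>F\<close> are adjacent to both \<open>u\<close> and \<open>v\<close>; the matching consists of an edge from \<open>u\<close> to
  one leaf and an edge from \<open>v\<close> to another.  Suppose that at most one vertex separates \<open>X\<close>, which avoids
  \<open>u\<close> and \<open>v\<close>, from the rest.  Then \<open>X\<close> contains a leaf, which has lost at most one of its edges to \<open>u\<close>
  and \<open>v\<close>.  This suffices unless the separating vertex is itself \<open>u\<close> or \<open>v\<close>; but then \<open>X\<close> is a union of
  components of \<open>F\<close> and contains two leaves, at most one of which has lost its edge to the other
  vertex of \<open>uv\<close>.\<close>

lemma removable_if_two_connected:
  assumes card: "2 < card (verts G)"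
    and deg3: "\<And>z. z \<in> verts G \<Longrightarrow> 3 \<le> deg (edges G) z"
  shows "\<exists>M. l_matching 2 G M \<and> k_removable 2 G M"
proof -
  have WV: "z \<in> verts G" if "z \<in> W" for z using that by (simp add: W_def)
  have F1: "deg F z \<noteq> 0" if "z \<in> W" for z
    using deg_split[OF that] deg3[OF WV[OF that]] by (auto split: if_splits)
  have leaf: "{u, z} \<in> edges G \<and> {v, z} \<in> edges G" if "z \<in> leaves F" "z \<in> W" for z
    using deg_split[OF that(2)] deg3[OF WV[OF that(2)]] that(1)
    by (auto simp: leaves_def split: if_splits)
  have "W \<noteq> {}"
  proof
    assume "W = {}"
    then have "verts G \<subseteq> {u, v}" by (auto simp: W_def)
    then have "card (verts G) \<le> card {u, v}" by (intro card_mono) auto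
    then show False using card u_neq_v by simp
  qed
  then obtain y where y: "y \<in> W" by blast
  have "2 \<le> card (leaves F \<inter> W) + card ({} :: 'a set)"
    by (rule leaves_meeting(1)[OF _ _ y F1[OF y]]) (use F_verts in auto)
  then have "2 \<le> card (leaves F \<inter> W)" by simp
  then obtain w w' where w: "w \<in> leaves F \<inter> W" "w' \<in> leaves F \<inter> W" "w \<noteq> w'"
    by (rule two_elements)
  let ?M = "{{u, w}, {v, w'}}"
  have match: "l_matching 2 G ?M" by (rule two_matching) (use w leaf in auto)
  have "k_connected 2 (delete_edges G ?M)"
  proof (rule ccontr)
    assume not: "\<not> ?thesis"
    obtain A S X where sep: "separation (delete_edges G ?M) A S X" and S: "card S < 2" "finite S"
      and uX: "u \<notin> X" and vX: "v \<notin> X"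
      and meet: "\<And>e. e \<in> F \<Longrightarrow> e \<inter> X \<noteq> {} \<Longrightarrow> e \<subseteq> X \<union> (S - {u, v})"
      and XW: "X \<subseteq> W"
      and au: "\<And>z. z \<in> X \<Longrightarrow> u \<in> A \<Longrightarrow> {u, z} \<in> edges G \<Longrightarrow> z = w"
      and av: "\<And>z. z \<in> X \<Longrightarrow> v \<in> A \<Longrightarrow> {v, z} \<in> edges G \<Longrightarrow> z = w'"
      using separation_avoiding_uv[OF _ _ card not] w by blast
    obtain x where x: "x \<in> X" using sep by (auto simp: separation_def)
    have xF: "deg F x \<noteq> 0" using F1 XW x by blast
    have two: "2 \<le> card (leaves F \<inter> X) + card (S - {u, v})"
      by (rule leaves_meeting(1)[OF _ meet x xF]) (use S in auto)
    have uS: "u \<in> A \<or> u \<in> S" and vS: "v \<in> A \<or> v \<in> S"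
      using sep u_vert v_vert uX vX by (auto simp: separation_def delete_edges_def)
    have S1: "a = b" if "a \<in> S" "b \<in> S" for a b
      using S that card_le_Suc0_iff_eq[OF S(2)] by (auto simp: less_Suc_eq_le numeral_2_eq_2)
    show False
    proof (cases "u \<in> S \<or> v \<in> S")
      case True
      then have se: "S - {u, v} = {}" using S1 by blast
      have "2 \<le> card (leaves F \<inter> X)" using two unfolding se by simp
      then obtain a b where ab: "a \<in> leaves F \<inter> X" "b \<in> leaves F \<inter> X" "a \<noteq> b"
        by (rule two_elements)
      have "u \<in> A \<or> v \<in> A" using uS vS S1 u_neq_v by blast
      then show False using ab au av leaf XW by blast
    next
      case False
      then have "u \<in> A" "v \<in> A" using uS vS by auto
      have "card (S - {u, v}) \<le> card S" using S by (intro card_mono) auto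
      then have "leaves F \<inter> X \<noteq> {}" using two S(1) by auto
      then obtain a where "a \<in> leaves F" "a \<in> X" by blast
      then have "a = w" "a = w'" using au av leaf XW \<open>u \<in> A\<close> \<open>v \<in> A\<close> by blast+
      then show False using w by simp
    qed
  qed
  then show ?thesis using match by (auto simp: k_removable_def l_matching_def)
qed

text \<open>The obstruction to removing \<open>uw\<close> and \<open>vw'\<close> for \<open>k = 1\<close>.  It is the vertex set of a path in \<open>F\<close> from \<open>w\<close>
  to \<open>w'\<close> that the two edges alone attach to \<open>u\<close> and \<open>v\<close>, described by degrees and closure under \<open>F\<close>
  rather than by listing the path, so that two such sets can be intersected.\<close>

definition blocking :: "'a \<Rightarrow> 'a \<Rightarrow> 'a set \<Rightarrow> bool" where
  "blocking w w' X \<longleftrightarrow>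
     X \<subseteq> W \<and> w \<in> X \<and> w' \<in> X \<and> (\<forall>e\<in>F. e \<inter> X \<noteq> {} \<longrightarrow> e \<subseteq> X) \<and>
     (\<forall>z\<in>X. deg F z \<noteq> 0 \<and> deg (edges G) z = 2 \<and>
        ({u, z} \<in> edges G \<longrightarrow> z = w) \<and> ({v, z} \<in> edges G \<longrightarrow> z = w'))"

lemma leaf_attached:
  assumes "2 \<le> deg (edges G) z" "z \<in> W" "deg F z \<le> 1"
  shows "{u, z} \<in> edges G \<or> {v, z} \<in> edges G"
  using deg_split[OF assms(2)] assms(1,3) by (auto split: if_splits)

text \<open>The side \<open>X\<close> that falls off is a union of components of \<open>F\<close>, and only \<open>uw\<close> and \<open>vw'\<close> attach it.  A vertex
  of \<open>X\<close> on no edge of \<open>F\<close> would be adjacent to both \<open>u\<close> and \<open>v\<close>, which \<open>w \<noteq> w'\<close> excludes.  So \<open>X\<close>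
  contains at least two leaves, and as leaves are attached to \<open>u\<close> or \<open>v\<close>, they are \<open>w\<close> and \<open>w'\<close>.  A forest
  with two leaves has no vertex of degree greater than 2.\<close>

lemma blocking_exists:
  assumes card: "1 < card (verts G)"
    and deg2: "\<And>z. z \<in> verts G \<Longrightarrow> 2 \<le> deg (edges G) z"
    and none: "\<not> (\<exists>M. l_matching 2 G M \<and> k_removable 1 G M)"
    and w: "w \<in> W" "w' \<in> W" "w \<noteq> w'" "{u, w} \<in> edges G" "{v, w'} \<in> edges G"
  shows "\<exists>X. blocking w w' X"
proof -
  let ?M = "{{u, w}, {v, w'}}"
  have "l_matching 2 G ?M" by (rule two_matching[OF w])
  then have not: "\<not> k_connected 1 (delete_edges G ?M)"
    using none by (auto simp: k_removable_def l_matching_def)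
  obtain A S X where sep: "separation (delete_edges G ?M) A S X" and S: "card S < 1" "finite S"
    and uX: "u \<notin> X" and vX: "v \<notin> X"
    and meet: "\<And>e. e \<in> F \<Longrightarrow> e \<inter> X \<noteq> {} \<Longrightarrow> e \<subseteq> X \<union> (S - {u, v})"
    and XW: "X \<subseteq> W"
    and au: "\<And>z. z \<in> X \<Longrightarrow> u \<in> A \<Longrightarrow> {u, z} \<in> edges G \<Longrightarrow> z = w"
    and av: "\<And>z. z \<in> X \<Longrightarrow> v \<in> A \<Longrightarrow> {v, z} \<in> edges G \<Longrightarrow> z = w'"
    using separation_avoiding_uv[OF w(1,2) card not] by blast
  have "S = {}" using S by simp
  then have "u \<in> A" "v \<in> A"
    using sep u_vert v_vert uX vX by (auto simp: separation_def delete_edges_def)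
  note au = au[OF _ \<open>u \<in> A\<close>] and av = av[OF _ \<open>v \<in> A\<close>]
  have degX: "2 \<le> deg (edges G) z" if "z \<in> X" for z
    using deg2 that XW by (auto simp: W_def)
  have F1: "deg F z \<noteq> 0" if z: "z \<in> X" for z
  proof
    assume "deg F z = 0"
    moreover have "z \<in> W" using z XW by blast
    ultimately have "{u, z} \<in> edges G" "{v, z} \<in> edges G"
      using degX[OF z] deg_split[of z] by (auto split: if_splits)
    then show False using au[OF z] av[OF z] w(3) by blast
  qed
  obtain x where x: "x \<in> X" using sep by (auto simp: separation_def)
  have closed: "e \<subseteq> X \<union> {}" if "e \<in> F" "e \<inter> X \<noteq> {}" for e
    using meet[OF that] \<open>S = {}\<close> by blast
  have L2: "2 \<le> card (leaves F \<inter> X)"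
    and Ld: "\<And>z. z \<in> X \<Longrightarrow> deg F z \<le> card (leaves F \<inter> X)"
    using leaves_meeting[OF finite.emptyI closed x F1[OF x]] by simp_all
  have Lw: "leaves F \<inter> X \<subseteq> {w, w'}"
  proof
    fix z assume z: "z \<in> leaves F \<inter> X"
    then have "z \<in> X" "z \<in> W" "deg F z \<le> 1" using XW by (auto simp: leaves_def)
    then have "{u, z} \<in> edges G \<or> {v, z} \<in> edges G"
      using leaf_attached[of z] degX[of z] by blast
    then show "z \<in> {w, w'}" using au av z by blast
  qed
  have Leq: "leaves F \<inter> X = {w, w'}"
    by (rule card_seteq[OF _ Lw]) (use L2 w(3) in auto)
  then have "w \<in> leaves F \<inter> X" "w' \<in> leaves F \<inter> X" by blast+
  moreover have "card (leaves F \<inter> X) = 2" unfolding Leq using w(3) by simp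
  ultimately have wX: "w \<in> X" "w' \<in> X" "deg F w = 1" "deg F w' = 1" "card (leaves F \<inter> X) = 2"
    by (simp_all add: leaves_def)
  have deg_eq: "deg (edges G) z = 2" if z: "z \<in> X" for z
  proof -
    have zW: "z \<in> W" using z XW by blast
    have "deg (edges G) z \<le> 2"
    proof (cases "z = w \<or> z = w'")
      case True
      then have "deg F z = 1" using wX by blast
      moreover have "\<not> ({u, z} \<in> edges G \<and> {v, z} \<in> edges G)"
        using au[OF z] av[OF z] w(3) by blast
      ultimately show ?thesis using deg_split[OF zW] by auto
    next
      case False
      then have "{u, z} \<notin> edges G" "{v, z} \<notin> edges G" using au[OF z] av[OF z] by blast+
      then show ?thesis using deg_split[OF zW] Ld[OF z] wX by simp
    qed
    then show ?thesis using degX[OF z] by simp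
  qed
  have "\<forall>e\<in>F. e \<inter> X \<noteq> {} \<longrightarrow> e \<subseteq> X" using closed by simp
  moreover have "deg F z \<noteq> 0 \<and> deg (edges G) z = 2 \<and>
        ({u, z} \<in> edges G \<longrightarrow> z = w) \<and> ({v, z} \<in> edges G \<longrightarrow> z = w')" if "z \<in> X" for z
    using F1[OF that] deg_eq[OF that] au[OF that] av[OF that] by blast
  ultimately have "blocking w w' X"
    unfolding blocking_def using XW wX(1,2) by blast
  then show ?thesis ..
qed

text \<open>The intersection is again a union of components of \<open>F\<close>, so it contains two leaves; these are attached to
  \<open>u\<close> or \<open>v\<close> in a way that both sets permit.\<close>

lemma blocking_meet:
  assumes X: "blocking w w' X" and Z: "blocking z z' Z" and "y \<in> X" "y \<in> Z"
  shows "w = z \<and> w' = z'"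
proof -
  have X': "X \<subseteq> W" "\<And>e. e \<in> F \<Longrightarrow> e \<inter> X \<noteq> {} \<Longrightarrow> e \<subseteq> X"
    "\<And>p. p \<in> X \<Longrightarrow> deg F p \<noteq> 0 \<and> deg (edges G) p = 2"
    "\<And>p. p \<in> X \<Longrightarrow> {u, p} \<in> edges G \<Longrightarrow> p = w"
    "\<And>p. p \<in> X \<Longrightarrow> {v, p} \<in> edges G \<Longrightarrow> p = w'"
    using X unfolding blocking_def by blast+
  have Z': "\<And>e. e \<in> F \<Longrightarrow> e \<inter> Z \<noteq> {} \<Longrightarrow> e \<subseteq> Z"
    "\<And>p. p \<in> Z \<Longrightarrow> {u, p} \<in> edges G \<Longrightarrow> p = z"
    "\<And>p. p \<in> Z \<Longrightarrow> {v, p} \<in> edges G \<Longrightarrow> p = z'"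
    using Z unfolding blocking_def by blast+
  have "e \<subseteq> (X \<inter> Z) \<union> {}" if "e \<in> F" "e \<inter> (X \<inter> Z) \<noteq> {}" for e
    using X'(2)[OF that(1)] Z'(1)[OF that(1)] that(2) by blast
  then have "2 \<le> card (leaves F \<inter> (X \<inter> Z)) + card ({} :: 'a set)"
    using assms(3,4) X'(3)[OF assms(3)] by (intro leaves_meeting(1)[of "{}" "X \<inter> Z" y]) auto
  then have "2 \<le> card (leaves F \<inter> (X \<inter> Z))" by simp
  then obtain a b where ab: "a \<in> leaves F \<inter> (X \<inter> Z)" "b \<in> leaves F \<inter> (X \<inter> Z)" "a \<noteq> b"
    by (rule two_elements)
  have att: "p = w \<and> w = z \<or> p = w' \<and> w' = z'" if p: "p \<in> leaves F \<inter> (X \<inter> Z)" for p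
  proof -
    have "p \<in> X" "p \<in> Z" "deg F p \<le> 1" using p by (auto simp: leaves_def)
    then have "{u, p} \<in> edges G \<or> {v, p} \<in> edges G"
      using leaf_attached[of p] X'(1) X'(3)[of p] by auto
    then show ?thesis
      using X'(4,5)[OF \<open>p \<in> X\<close>] Z'(2,3)[OF \<open>p \<in> Z\<close>] by blast
  qed
  show ?thesis using att[OF ab(1)] att[OF ab(2)] ab(3) by blast
qed

lemma deg_le_two:
  assumes "\<And>y. {p, y} \<in> edges G \<Longrightarrow> y \<in> {a, b}"
  shows "deg (edges G) p \<le> 2"
proof -
  have "deg (edges G) p \<le> card {a, b}"
    using deg_le_card_neighbours[of "edges G" "{a, b}" p] card_edge assms by blast
  moreover have "card {a, b} \<le> 2" by (cases "a = b") simp_all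
  ultimately show ?thesis by (rule le_trans)
qed

text \<open>If different vertices \<open>w\<close> and \<open>w'\<close> of \<open>W\<close> are adjacent to \<open>u\<close> and to \<open>v\<close>, there is a blocking set \<open>X\<close>.
  A vertex of \<open>W\<close> outside \<open>X\<close> attached to \<open>u\<close> could replace \<open>w\<close>, and one attached to \<open>v\<close> could replace \<open>w'\<close>;
  the new blocking set would meet \<open>X\<close>, which \<open>blocking_meet\<close> excludes.  As \<open>W - X\<close> is a union of components
  of \<open>F\<close>, it would contain an attached vertex if it were not empty; so \<open>X\<close> is all of \<open>W\<close>.
  In the other case a single vertex of \<open>W\<close> is adjacent to \<open>u\<close> or \<open>v\<close>, and \<open>G\<close> is a triangle.\<close>

lemma two_regular_if_not_removable:
  assumes card: "1 < card (verts G)"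
    and deg2: "\<And>z. z \<in> verts G \<Longrightarrow> 2 \<le> deg (edges G) z"
    and none: "\<not> (\<exists>M. l_matching 2 G M \<and> k_removable 1 G M)"
    and z: "z \<in> verts G"
  shows "deg (edges G) z = 2"
proof -
  have block: "\<exists>X. blocking w w' X"
    if "w \<in> W" "w' \<in> W" "w \<noteq> w'" "{u, w} \<in> edges G" "{v, w'} \<in> edges G" for w w'
    using blocking_exists[OF card deg2 none that] by blast
  have degW: "2 \<le> deg (edges G) y" if "y \<in> W" for y using deg2 that by (simp add: W_def)
  have nbu: "y = v \<or> y \<in> W" if "{u, y} \<in> edges G" for y
    using edge_verts[OF that] by (auto simp: W_def)
  have nbv: "y = u \<or> y \<in> W" if "{v, y} \<in> edges G" for y
    using edge_verts[OF that] by (auto simp: W_def)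
  have "\<exists>w\<in>W. {u, w} \<in> edges G"
  proof (rule ccontr)
    assume "\<not> ?thesis"
    then have "deg (edges G) u \<le> card {v}"
      using nbu card_edge by (intro deg_le_card_neighbours) blast+
    then show False using deg2[OF u_vert] by simp
  qed
  then obtain w where w: "w \<in> W" "{u, w} \<in> edges G" by blast
  have "\<exists>w'\<in>W. {v, w'} \<in> edges G"
  proof (rule ccontr)
    assume "\<not> ?thesis"
    then have "deg (edges G) v \<le> card {u}"
      using nbv card_edge by (intro deg_le_card_neighbours) blast+
    then show False using deg2[OF v_vert] by simp
  qed
  then obtain w' where w': "w' \<in> W" "{v, w'} \<in> edges G" by blast
  have "deg (edges G) z \<le> 2"
  proof (cases "\<exists>w\<in>W. \<exists>w'\<in>W. w \<noteq> w' \<and> {u, w} \<in> edges G \<and> {v, w'} \<in> edges G")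
    case True
    then obtain w w' where w: "w \<in> W" "w' \<in> W" "w \<noteq> w'" "{u, w} \<in> edges G" "{v, w'} \<in> edges G"
      by blast
    obtain X where X: "blocking w w' X" using block[OF w] by blast
    have wX: "w \<in> X" "w' \<in> X" "X \<subseteq> W" using X unfolding blocking_def by blast+
    have closed: "\<And>e. e \<in> F \<Longrightarrow> e \<inter> X \<noteq> {} \<Longrightarrow> e \<subseteq> X"
      using X unfolding blocking_def by blast
    have attX: "\<And>y. y \<in> X \<Longrightarrow> {u, y} \<in> edges G \<Longrightarrow> y = w" "\<And>y. y \<in> X \<Longrightarrow> {v, y} \<in> edges G \<Longrightarrow> y = w'"
      using X unfolding blocking_def by blast+
    have noatt: "\<not> ({u, y} \<in> edges G \<or> {v, y} \<in> edges G)" if y: "y \<in> W - X" for y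
    proof
      assume "{u, y} \<in> edges G \<or> {v, y} \<in> edges G"
      then show False
      proof
        assume "{u, y} \<in> edges G"
        moreover have "y \<noteq> w'" using y wX by blast
        ultimately obtain Z where Z: "blocking y w' Z" using block[of y w'] w y by blast
        then have "w' \<in> Z" by (simp add: blocking_def)
        then show False using blocking_meet[OF X Z] wX y by blast
      next
        assume "{v, y} \<in> edges G"
        moreover have "w \<noteq> y" using y wX by blast
        ultimately obtain Z where Z: "blocking w y Z" using block[of w y] w y by blast
        then have "w \<in> Z" by (simp add: blocking_def)
        then show False using blocking_meet[OF X Z] wX y by blast
      qed
    qed
    have "W - X = {}"
    proof (rule ccontr)
      assume "W - X \<noteq> {}"
      then obtain y where y: "y \<in> W - X" by blast
      have "deg F y \<noteq> 0"
        using leaf_attached[of y] noatt[OF y] degW[of y] y by fastforce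
      moreover have "e \<subseteq> (W - X) \<union> {}" if "e \<in> F" "e \<inter> (W - X) \<noteq> {}" for e
        using that closed F_verts by blast
      ultimately have "2 \<le> card (leaves F \<inter> (W - X)) + card ({} :: 'a set)"
        using y by (intro leaves_meeting(1)[of "{}" "W - X" y]) auto
      then have "leaves F \<inter> (W - X) \<noteq> {}" by auto
      then obtain l where l: "l \<in> leaves F" "l \<in> W - X" by blast
      then have "deg F l \<le> 1" by (simp add: leaves_def)
      then show False using leaf_attached[of l] degW[of l] noatt[OF l(2)] l(2) by blast
    qed
    then have WX: "W = X" using wX by blast
    have "deg (edges G) u \<le> 2"
      by (rule deg_le_two[of _ v w]) (use nbu attX WX in blast)
    moreover have "deg (edges G) v \<le> 2"
      by (rule deg_le_two[of _ u w']) (use nbv attX WX in blast)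
    moreover have "deg (edges G) y \<le> 2" if "y \<in> W" for y
    proof -
      have "deg (edges G) y = 2" using that X unfolding WX blocking_def by blast
      then show ?thesis by simp
    qed
    ultimately show ?thesis using z by (auto simp: W_def)
  next
    case False
    then have same: "w' = w" using w w' by metis
    have uw: "y = w" if "y \<in> W" "{u, y} \<in> edges G" for y using False that w' unfolding same by metis
    have vw: "y = w" if "y \<in> W" "{v, y} \<in> edges G" for y using False that w by metis
    have F0: "deg F y = 0" if y: "y \<in> W" for y
    proof (rule ccontr)
      assume Fy: "deg F y \<noteq> 0"
      have "2 \<le> card (leaves F \<inter> W) + card ({} :: 'a set)"
        by (rule leaves_meeting(1)[OF _ _ y Fy]) (use F_verts in auto)
      then have "2 \<le> card (leaves F \<inter> W)" by simp
      then obtain a b where ab: "a \<in> leaves F \<inter> W" "b \<in> leaves F \<inter> W" "a \<noteq> b"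
        by (rule two_elements)
      have leaf_w: "p = w" if p: "p \<in> leaves F \<inter> W" for p
      proof -
        have "p \<in> W" "deg F p \<le> 1" using p by (auto simp: leaves_def)
        then have "{u, p} \<in> edges G \<or> {v, p} \<in> edges G" using leaf_attached degW by blast
        then show ?thesis using uw[OF \<open>p \<in> W\<close>] vw[OF \<open>p \<in> W\<close>] by (elim disjE)
      qed
      show False using leaf_w[OF ab(1)] leaf_w[OF ab(2)] ab(3) by simp
    qed
    have "deg (edges G) u \<le> 2"
      by (rule deg_le_two[of _ v w]) (use nbu uw in blast)
    moreover have "deg (edges G) v \<le> 2"
      by (rule deg_le_two[of _ u w]) (use nbv vw in blast)
    moreover have "deg (edges G) y \<le> 2" if "y \<in> W" for y
      using deg_split[OF that] F0[OF that] by simp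
    ultimately show ?thesis using z by (auto simp: W_def)
  qed
  then show ?thesis using deg2[OF z] by simp
qed

end

section \<open>Removable 2-matchings\<close>

theorem theorem1p6:
  fixes k :: nat and G :: "'a graph"
  assumes "k \<ge> 1"
    and "simple_graph G"
    and "k_connected k G"
    and "min_degree G \<ge> k + 1"
    and "\<not> (k = 1 \<and> is_cycle G)"
  shows "\<exists>M. l_matching 2 G M \<and> k_removable k G M"
proof (rule ccontr)
  assume none: "\<not> ?thesis"
  note k = \<open>k \<ge> 1\<close> and simple = \<open>simple_graph G\<close> and conn = \<open>k_connected k G\<close>
  have finV: "finite (verts G)" using simple by (simp add: simple_graph_def)
  have card: "k < card (verts G)" using conn by (simp add: k_connected_def)
  have deg: "k < deg (edges G) z" if "z \<in> verts G" for z
  proof -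
    have "min_degree G \<le> degree G z"
      unfolding min_degree_def using finV that by (intro Min_le) auto
    then show ?thesis using assms(4) by (simp add: degree_eq_deg)
  qed
  have eV: "\<Union>(edges G) \<subseteq> verts G" using simple by (auto simp: simple_graph_def)
  have "verts G \<noteq> {}" using card by auto
  then obtain z0 where z0: "z0 \<in> verts G" by blast
  have "{e \<in> edges G. z0 \<in> e} \<noteq> {}"
  proof
    assume "{e \<in> edges G. z0 \<in> e} = {}"
    then have "deg (edges G) z0 = 0" unfolding deg_def by (simp only: card.empty)
    then show False using deg[OF z0] by simp
  qed
  then have "edges G \<noteq> {}" by blast
  have no1: "\<not> (\<exists>z. deg (edges G) z = 1)"
  proof
    assume "\<exists>z. deg (edges G) z = 1"
    then obtain z where z: "deg (edges G) z = 1" by blast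
    then have "z \<in> leaves (edges G)" by (simp add: leaves_def)
    then have "z \<in> verts G" using leaves_subset[of "edges G"] eV by blast
    then show False using deg[of z] z k by simp
  qed
  have "\<exists>e\<in>edges G. k_connected k (delete_edges G {e})"
  proof (rule ccontr)
    assume "\<not> ?thesis"
    then have "\<exists>z. deg (edges G) z = 1"
      using deg eV by (intro mader_critical_edges[OF simple conn order_refl \<open>edges G \<noteq> {}\<close>]) blast+
    then show False using no1 by blast
  qed
  then obtain e where e: "e \<in> edges G" and ke: "k_connected k (delete_edges G {e})" by blast
  have "card e = 2" using simple e by (auto simp: simple_graph_def)
  then obtain u v where uv: "e = {u, v}" by (auto simp: card_2_iff)
  define D where "D = {f \<in> edges G. f \<inter> {u, v} = {}}"
  let ?G' = "delete_edges G {e}"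
  have "forest D"
    unfolding forest_def
  proof (intro allI impI)
    fix H assume H: "H \<subseteq> D" "H \<noteq> {}"
    show "\<exists>z. deg H z = 1"
    proof (rule mader_critical_edges[OF simple_graph_delete_edges[OF simple] ke _ H(2)])
      show "H \<subseteq> edges ?G'" using H uv by (auto simp: D_def delete_edges_def)
      fix f assume "f \<in> H"
      then have f: "f \<in> edges G" "f \<inter> {u, v} = {}" using H by (auto simp: D_def)
      then have "e \<noteq> f" using uv by auto
      then have "l_matching 2 G {e, f}"
        using e f uv by (auto simp: l_matching_def matching_def)
      then have "\<not> k_connected k (delete_edges G {e, f})"
        using none by (auto simp: k_removable_def l_matching_def)
      moreover have "delete_edges ?G' {f} = delete_edges G {e, f}"
        by (auto simp: delete_edges_def)
      ultimately show "\<not> k_connected k (delete_edges ?G' {f})" by simp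
    next
      fix z assume "z \<in> \<Union>H"
      then have z: "z \<in> verts G" "z \<notin> e" using H eV uv by (auto simp: D_def)
      then have "{d \<in> edges ?G'. z \<in> d} = {d \<in> edges G. z \<in> d}"
        by (auto simp: delete_edges_def)
      then show "k < deg (edges ?G') z" using deg[OF z(1)] by (simp add: deg_def)
    qed
  qed
  then interpret edge_with_forest G u v
    using simple e uv by unfold_locales (auto simp: D_def)
  have "k = 1 \<or> k = 2 \<or> 3 \<le> k" using k by linarith
  then show False
  proof (elim disjE)
    assume k1: "k = 1"
    have "2 \<le> deg (edges G) z" if "z \<in> verts G" for z using deg[OF that] k1 by simp
    then have "deg (edges G) z = 2" if "z \<in> verts G" for z
      using two_regular_if_not_removable[OF _ _ _ that] card none k1 by blast
    then have "is_cycle G"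
      using connected_two_regular_is_cycle[OF simple] conn k1 by blast
    then show False using assms(5) k1 by blast
  next
    assume k2: "k = 2"
    have "3 \<le> deg (edges G) z" if "z \<in> verts G" for z using deg[OF that] k2 by simp
    then have "\<exists>M. l_matching 2 G M \<and> k_removable 2 G M"
      using removable_if_two_connected card k2 by blast
    then show False using none k2 by blast
  next
    assume k3: "3 \<le> k"
    have "\<not> verts G \<subseteq> {u, v}"
    proof
      assume "verts G \<subseteq> {u, v}"
      then have "card (verts G) \<le> card {u, v}" by (intro card_mono) auto
      also have "\<dots> \<le> 2" by (simp add: card_insert_if)
      finally show False using card k3 by simp
    qed
    then obtain y where y: "y \<in> W" by (auto simp: W_def)
    have big: "2 \<le> deg F z" if "z \<in> W" for z
      using deg_split[OF that] deg[of z] that k3 by (auto simp: W_def split: if_splits)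
    have "F \<noteq> {}" using big[OF y] by (auto simp: deg_def)
    then obtain z where z: "deg F z = 1"
      using \<open>forest D\<close> unfolding forest_def D_def F_def by blast
    then have "z \<in> W" using leaves_subset[of F] F_verts by (auto simp: leaves_def)
    then show False using big z by fastforce
  qed
qed

end
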